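(* Let $T$ be a locally finite infinite tree rooted at $\rho$ with branching factor $b$. The hard core model with vertex activity $\lambda>0$ exhibits uniqueness of Gibbs measure on $T$ if at least one of the following holds: (1) $\lambda<\lambda_c(b+1)$; (2) $T$ is spherically symmetric and $\lambda<\lambda_c(b)$, where $\lambda_c(D)=\frac{D^D}{(D-1)^{D+1}}$.
   Context: A cutset of $T$ is a finite set $C$ of vertices such that every infinite path from $\rho$ meets $C$ and no vertex of $C$ is an ancestor of another; $d(\rho,C)=\min_{v\in C}d(\rho,v)$, $|v|=d(\rho,v)$, and $T_{<C}$ is the set of vertices that are neither in $C$ nor descendants of vertices in $C$. Hard core model with activity $\lambda$: independent sets $I$ weighted $\lambda^{|I|}$; for a boundary condition $\sigma$ (fixed occupied/unoccupied states on some vertices, consistent with an independent set), $R_\rho(\sigma,T)=p/(1-p)$ with $p$ the conditional probability that $\rho$ is occupied. The discrepancy $\delta(C)$ of a cutset $C$ is the maximum of $R_\rho(\sigma,T)-R_\rho(\tau,T)$ over boundary conditions $\sigma,\tau$ that fix the states of all vertices of $C$ and of no vertex in $T_{<C}$. Uniqueness of Gibbs measure on $T$ means there is a sequence of cutsets $(B_i)$ with $d(\rho,B_i)\to\infty$ and $\delta(B_i)\to0$. The branching factor is $\mathrm{br}(T)=\inf\{b>0:\inf_C\sum_{v\in C}b^{-|v|}=0\}$, the inner infimum over all cutsets $C$. $T$ is spherically symmetric if the degree of each vertex depends only on its distance from $\rho$. *)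

theory Defs
  imports "HOL-Analysis.Analysis"
begin

text \<open>A rooted tree is a set of vertices of type nat list (the root is the empty list,
  the children of v are the vertices v @ [i]).\<close>

definition rooted_tree :: "nat list set \<Rightarrow> bool" where
  "rooted_tree T \<longleftrightarrow> [] \<in> T \<and> (\<forall>v i. v @ [i] \<in> T \<longrightarrow> v \<in> T)"

definition children :: "nat list set \<Rightarrow> nat list \<Rightarrow> nat set" where
  "children T v = {i. v @ [i] \<in> T}"

definition locally_finite_tree :: "nat list set \<Rightarrow> bool" where
  "locally_finite_tree T \<longleftrightarrow> (\<forall>v\<in>T. finite (children T v))"

definition degree :: "nat list set \<Rightarrow> nat list \<Rightarrow> nat" where
  "degree T v = card (children T v) + (if v = [] then 0 else 1)"

definition spherically_symmetric :: "nat list set \<Rightarrow> bool" where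
  "spherically_symmetric T \<longleftrightarrow>
     (\<forall>u\<in>T. \<forall>v\<in>T. length u = length v \<longrightarrow> degree T u = degree T v)"

definition anc_eq :: "nat list \<Rightarrow> nat list \<Rightarrow> bool" where
  "anc_eq u v \<longleftrightarrow> (\<exists>w. v = u @ w)"

definition ancestor :: "nat list \<Rightarrow> nat list \<Rightarrow> bool" where
  "ancestor u v \<longleftrightarrow> (\<exists>w. w \<noteq> [] \<and> v = u @ w)"

definition infinite_path :: "nat list set \<Rightarrow> (nat \<Rightarrow> nat list) \<Rightarrow> bool" where
  "infinite_path T f \<longleftrightarrow> f 0 = [] \<and> (\<forall>n. f n \<in> T \<and> (\<exists>i. f (Suc n) = f n @ [i]))"

definition cutset :: "nat list set \<Rightarrow> nat list set \<Rightarrow> bool" where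
  "cutset T C \<longleftrightarrow> finite C \<and> C \<subseteq> T \<and>
     (\<forall>f. infinite_path T f \<longrightarrow> (\<exists>n. f n \<in> C)) \<and>
     (\<forall>u\<in>C. \<forall>v\<in>C. \<not> ancestor u v)"

definition dist_root :: "nat list set \<Rightarrow> nat" where
  "dist_root C = Min (length ` C)"

definition T_below :: "nat list set \<Rightarrow> nat list set \<Rightarrow> nat list set" where
  "T_below T C = {v\<in>T. \<forall>u\<in>C. \<not> anc_eq u v}"

definition independent :: "nat list set \<Rightarrow> bool" where
  "independent A \<longleftrightarrow> (\<forall>u\<in>A. \<forall>i. u @ [i] \<notin> A)"

text \<open>Partition function of the hard core model on T_{<C}, with the boundary condition
  on C given by the set S of occupied vertices of C, restricted to configurations where
  the root is occupied (occ = True) or unoccupied (occ = False).\<close>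
definition hc_Z :: "nat list set \<Rightarrow> real \<Rightarrow> nat list set \<Rightarrow> nat list set \<Rightarrow> bool \<Rightarrow> real" where
  "hc_Z T lam C S occ =
     (\<Sum>I\<in>{I\<in>Pow (T_below T C). independent (I \<union> S) \<and> ([] \<in> I) = occ}. lam ^ card I)"

text \<open>R_rho(sigma,T) = p/(1-p) = Z(root occupied)/Z(root unoccupied).\<close>
definition hc_R :: "nat list set \<Rightarrow> real \<Rightarrow> nat list set \<Rightarrow> nat list set \<Rightarrow> real" where
  "hc_R T lam C S = hc_Z T lam C S True / hc_Z T lam C S False"

definition discrepancy :: "nat list set \<Rightarrow> real \<Rightarrow> nat list set \<Rightarrow> real" where
  "discrepancy T lam C = Max {hc_R T lam C S - hc_R T lam C S' | S S'. S \<subseteq> C \<and> S' \<subseteq> C}"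

definition gibbs_uniqueness :: "nat list set \<Rightarrow> real \<Rightarrow> bool" where
  "gibbs_uniqueness T lam \<longleftrightarrow>
     (\<exists>B :: nat \<Rightarrow> nat list set. (\<forall>i. cutset T (B i)) \<and>
        filterlim (\<lambda>i. dist_root (B i)) at_top sequentially \<and>
        (\<lambda>i. discrepancy T lam (B i)) \<longlonglongrightarrow> 0)"

text \<open>Branching factor, valued in the extended reals (infinite if no b works).\<close>
definition branching_factor :: "nat list set \<Rightarrow> ereal" where
  "branching_factor T = Inf {ereal b | b. b > 0 \<and>
      (INF C\<in>{C. cutset T C}. ereal (\<Sum>v\<in>C. b powr (- real (length v)))) = 0}"

text \<open>lambda_c(D) = D^D/(D-1)^(D+1); equal to +infinity for D \<le> 1 (limit at 1)
  and 0 for D = infinity (limit).\<close>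
definition lambda_c :: "ereal \<Rightarrow> ereal" where
  "lambda_c D = (case D of ereal d \<Rightarrow>
       (if d \<le> 1 then \<infinity> else ereal (d powr d / (d - 1) powr (d + 1)))
     | PInfty \<Rightarrow> 0 | MInfty \<Rightarrow> \<infinity>)"

end

theory Submission
  imports Defs
begin

text \<open>
  On a tree the occupation ratios satisfy \<open>R = \<lambda> \<Prod> 1 / (1 + R\<^sub>i)\<close>, the product ranging over the
  children. In the coordinate \<open>\<theta> = arsinh (sqrt R)\<close> this reads
  \<open>sinh \<theta> = sqrt \<lambda> * \<Prod> 1 / cosh \<theta>\<^sub>i\<close>, so \<open>ln (sinh \<theta>)\<close> has partial derivatives \<open>- tanh \<theta>\<^sub>i\<close>, and Hoelder's inequality with the exponents \<open>a, q\<close> where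
  \<open>2 / a = (D - 1) ln (D / (D - 1))\<close> turns the mean value theorem into
  \<open>\<bar>\<Delta>\<theta>\<bar> powr q \<le> (1 / D) * (\<Sum> \<bar>\<Delta>\<theta>\<^sub>i\<bar> powr q)\<close> for every number of children, as soon as
  \<open>\<lambda> \<le> \<lambda>\<^sub>c(D)\<close>. Iterating down to a cutset \<open>C\<close> bounds the discrepancy in terms of
  \<open>\<Sum>v\<in>C. D powr (- \<bar>v\<bar>)\<close>, which can be made arbitrarily small if \<open>D\<close> exceeds the branching
  factor \<open>b\<close>. Hence \<open>\<lambda> < \<lambda>\<^sub>c(b)\<close> suffices for every tree, and both cases follow.
\<close>

section \<open>The contraction estimate\<close>

text \<open>Dividing the factors by \<open>A powr (1 / p)\<close> and \<open>B powr (1 / q)\<close>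
  reduces to the normalised case, where Young's inequality summed over \<open>I\<close> gives 1 / p
  + 1 / q = 1. If \<open>A\<close> or \<open>B\<close> vanishes, so does every product.\<close>

lemma Hoelder_inequality_sum:
  fixes a b :: "'i \<Rightarrow> real"
  assumes pq: "p > 1" "q > 1" "1 / p + 1 / q = 1"
    and nonneg: "\<And>i. i \<in> I \<Longrightarrow> a i \<ge> 0" "\<And>i. i \<in> I \<Longrightarrow> b i \<ge> 0"
  shows "(\<Sum>i\<in>I. a i * b i) \<le>
    (\<Sum>i\<in>I. a i powr p) powr (1 / p) * (\<Sum>i\<in>I. b i powr q) powr (1 / q)"
proof (cases "finite I")
  case fin: True
  define A where "A = (\<Sum>i\<in>I. a i powr p)"
  define B where "B = (\<Sum>i\<in>I. b i powr q)"
  show ?thesis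
  proof (cases "A = 0 \<or> B = 0")
    case True
    then have "\<forall>i\<in>I. a i * b i = 0"
      unfolding A_def B_def using fin by (subst (asm) (1 2) sum_nonneg_eq_0_iff) auto
    then have "(\<Sum>i\<in>I. a i * b i) = 0" by (intro sum.neutral)
    then show ?thesis by simp
  next
    case False
    have "A \<ge> 0" "B \<ge> 0" unfolding A_def B_def by (auto intro: sum_nonneg)
    with False have AB: "A > 0" "B > 0" by auto
    have "(\<Sum>i\<in>I. (a i / A powr (1 / p)) * (b i / B powr (1 / q)))
        \<le> (\<Sum>i\<in>I. (a i / A powr (1 / p)) powr p / p + (b i / B powr (1 / q)) powr q / q)"
      using pq nonneg by (intro sum_mono Youngs_inequality) auto
    also have "\<dots> = (\<Sum>i\<in>I. a i powr p / A / p + b i powr q / B / q)"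
      using pq nonneg AB by (intro sum.cong refl) (simp add: powr_divide powr_powr)
    also have "\<dots> = A / A / p + B / B / q"
      by (simp add: A_def B_def sum.distrib flip: sum_divide_distrib)
    also have "\<dots> = 1" using AB pq by simp
    finally have "(\<Sum>i\<in>I. a i * b i) / (A powr (1 / p) * B powr (1 / q)) \<le> 1"
      by (simp add: sum_divide_distrib)
    then show ?thesis using AB by (simp add: A_def B_def divide_le_eq)
  qed
qed simp

text \<open>Convexity of exp: chord slopes from 0 increase. Concretely, \<open>exp s\<close> is a
  weighted geometric mean of \<open>exp t\<close> and 1, hence at most the arithmetic mean. This
  settles the sign of the derivative in the next lemma.\<close>

lemma exp_minus_one_over_mono:
  fixes s t :: real
  assumes "0 < s" "s \<le> t"
  shows "(exp s - 1) * t \<le> s * (exp t - 1)"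
proof -
  have "exp s = exp t powr (s / t) * 1 powr (1 - s / t)"
    using assms by (simp add: powr_def)
  also have "\<dots> \<le> s / t * exp t + (1 - s / t) * 1"
    using assms by (intro Youngs_inequality_0) auto
  finally have "(exp s - 1) * t \<le> s / t * (exp t - 1) * t"
    using assms by (intro mult_right_mono) (auto simp: algebra_simps)
  then show ?thesis using assms by simp
qed

text \<open>The function \<open>t \<mapsto> (1 - exp (- t)) powr (a / 2) / t\<close> attains its maximum at
  \<open>u = ln (D / (D - 1))\<close> precisely when \<open>2 / a = (D - 1) * u\<close>; this dictates the exponent.\<close>

lemma one_minus_exp_le_powr:
  fixes D t :: real
  defines "u \<equiv> ln (D / (D - 1))"
  assumes D: "D > 1" and t: "t > 0"
  shows "D * (1 - exp (- t)) \<le> (t / u) powr ((D - 1) * u)"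
proof -
  have u: "u > 0" using D by (simp add: u_def)
  have eu: "exp u = D / (D - 1)" using D by (simp add: u_def)
  then have "exp u - 1 = 1 / (D - 1)" using D by (simp add: field_simps)
  then have eu1: "D - 1 = 1 / (exp u - 1)" by simp
  define g where "g t = (D - 1) * u * ln t - ln (1 - exp (- t))" for t :: real
  define g' where "g' t = (D - 1) * u / t - exp (- t) / (1 - exp (- t))" for t :: real
  \<comment> \<open>The denominator is positive, so the numerator alone decides the sign:
    \<open>g\<close> decreases up to \<open>u\<close> and increases after it.\<close>
  have g'_eq: "g' z = (u * (exp z - 1) - z * (exp u - 1)) / (z * (exp z - 1) * (exp u - 1))"
    if "z > 0" for z
  proof -
    have 1: "exp (- z) / (1 - exp (- z)) = 1 / (exp z - 1)"
      using that by (simp add: exp_minus field_simps)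
    show ?thesis unfolding g'_def 1 eu1 using that u by (simp add: field_simps)
  qed
  have der: "DERIV g x :> g' x" if "x > 0" for x
    unfolding g_def g'_def using that
    by (auto intro!: derivative_eq_intros simp: field_simps)
  have "g u \<le> g t"
  proof (cases u t rule: linorder_cases)
    case less
    obtain z where z: "z > u" "z < t" "g t - g u = (t - u) * g' z"
      using MVT2[OF less, of g g'] der u by force
    have "g' z \<ge> 0" using exp_minus_one_over_mono[of u z] z u
      by (subst g'_eq) (auto simp: mult.commute intro!: divide_nonneg_nonneg mult_nonneg_nonneg)
    with z less show ?thesis by (smt (verit) mult_nonneg_nonneg)
  next
    case greater
    obtain z where z: "z > t" "z < u" "g u - g t = (u - t) * g' z"
      using MVT2[OF greater, of g g'] der t by force
    have "g' z \<le> 0" using exp_minus_one_over_mono[of z u] z t u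
      by (subst g'_eq) (auto simp: mult.commute intro!: divide_nonpos_nonneg mult_nonneg_nonneg)
    with z greater show ?thesis by (smt (verit) mult_nonneg_nonpos)
  qed simp
  moreover have "exp (- u) = (D - 1) / D" using eu D by (simp add: exp_minus field_simps)
  then have "1 - exp (- u) = 1 / D" using D by (simp add: field_simps)
  ultimately have "ln D + ln (1 - exp (- t)) \<le> (D - 1) * u * (ln t - ln u)"
    using D by (simp add: g_def ln_div algebra_simps)
  then have "ln (D * (1 - exp (- t))) \<le> (D - 1) * u * ln (t / u)"
    using D t u by (simp add: ln_mult ln_div)
  moreover have "D * (1 - exp (- t)) > 0" using D t by simp
  ultimately have "D * (1 - exp (- t)) \<le> exp ((D - 1) * u * ln (t / u))"
    by (metis exp_le_cancel_iff exp_ln)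
  then show ?thesis using t u by (simp add: powr_def)
qed

text \<open>For \<open>t0 = D * ln (D / (D - 1))\<close> the right-hand side is \<open>1 + exp t / \<lambda>\<^sub>c(D)\<close>. Equality holds at
  \<open>t = t0\<close>, the value at the fixed point of the \<open>D\<close>-ary recursion at criticality.\<close>

lemma powr_le_exp_mix:
  fixes D t t0 :: real
  assumes D: "D > 1" and t: "t \<ge> 0" and t0: "t0 > 0"
  shows "D * (t / t0) powr (t0 * (D - 1) / D) \<le> 1 + (D - 1) * exp (t - t0)"
proof (cases "t = 0")
  case False
  with t have t: "t > 0" by simp
  \<comment> \<open>The tangent bound for ln turns the power into a weighted geometric mean of
    \<open>exp (t - t0)\<close> and 1, to which the arithmetic-geometric mean inequality
    applies.\<close>
  have "ln (t / t0) \<le> t / t0 - 1" using t t0 by (intro ln_le_minus_one) auto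
  then have "t0 * (D - 1) / D * ln (t / t0) \<le> t0 * (D - 1) / D * (t / t0 - 1)"
    using D t0 by (intro mult_left_mono) auto
  also have "\<dots> = (D - 1) / D * (t - t0)" using D t0 by (simp add: field_simps)
  finally have "(t / t0) powr (t0 * (D - 1) / D) \<le> exp (t - t0) powr ((D - 1) / D) * 1 powr (1 / D)"
    using t t0 by (simp add: powr_def)
  also have "\<dots> \<le> (D - 1) / D * exp (t - t0) + 1 / D * 1"
    using D by (intro Youngs_inequality_0) (auto simp: field_simps)
  finally show ?thesis using D by (simp add: field_simps)
qed (use D in simp)

section \<open>Hoelder exponents and contraction of the ratio map\<close>

definition crit_exp :: "real \<Rightarrow> real" where
  "crit_exp D = 2 / ((D - 1) * ln (D / (D - 1)))"

definition conj_exp :: "real \<Rightarrow> real" where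
  "conj_exp D = crit_exp D / (crit_exp D - 1)"

lemma crit_exp_ge_2:
  assumes "D > 1"
  shows "crit_exp D \<ge> 2"
proof -
  have "ln (D / (D - 1)) \<le> D / (D - 1) - 1" using assms by (intro ln_le_minus_one) auto
  also have "\<dots> = 1 / (D - 1)" using assms by (simp add: field_simps)
  finally have "(D - 1) * ln (D / (D - 1)) \<le> 1" using assms by (simp add: field_simps)
  moreover have "(D - 1) * ln (D / (D - 1)) > 0" using assms by simp
  ultimately show ?thesis unfolding crit_exp_def by (subst le_divide_eq) auto
qed

lemma conj_exp_gt_1: "D > 1 \<Longrightarrow> conj_exp D > 1"
  using crit_exp_ge_2[of D] by (simp add: conj_exp_def less_divide_eq)

lemma crit_conj_exp:
  assumes "D > 1"
  shows "1 / crit_exp D + 1 / conj_exp D = 1"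
  using crit_exp_ge_2[OF assms] by (simp add: conj_exp_def field_simps)

text \<open>This bounds the dual norm of the gradient of the angle map, with \<open>c i\<close>
  standing for \<open>2 * ln (cosh \<theta>)\<close> at child \<open>i\<close>. The bound of each
  summand is linear in \<open>c i\<close>, so the sum is controlled by the total \<open>t\<close>
  alone, whatever the number of children; a one-variable inequality in \<open>t\<close>
  remains.\<close>

lemma contraction_factor:
  fixes D lam :: real and c :: "'i \<Rightarrow> real"
  defines "a \<equiv> crit_exp D" and "q \<equiv> conj_exp D"
  assumes D: "D > 1" and lam: "lam > 0" "lam \<le> D powr D / (D - 1) powr (D + 1)"
    and c: "\<And>i. i \<in> I \<Longrightarrow> c i \<ge> 0" and t_def: "t = (\<Sum>i\<in>I. c i)"
  shows "(1 + exp t / lam) powr (- 1 / 2) * (\<Sum>i\<in>I. (1 - exp (- c i)) powr (a / 2)) powr (1 / a)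
     \<le> D powr (- 1 / q)"
proof -
  define u where "u = ln (D / (D - 1))"
  have u: "u > 0" using D by (simp add: u_def)
  have a2: "a \<ge> 2" unfolding a_def by (rule crit_exp_ge_2[OF D])
  have au: "(D - 1) * u = 2 / a" using D u by (simp add: a_def crit_exp_def u_def)
  have qa: "1 / a + 1 / q = 1" unfolding a_def q_def by (rule crit_conj_exp[OF D])
  have t: "t \<ge> 0" unfolding t_def by (intro sum_nonneg c)
  have "(\<Sum>i\<in>I. (1 - exp (- c i)) powr (a / 2)) \<le> (\<Sum>i\<in>I. D powr (- a / 2) * (c i / u))"
  proof (intro sum_mono)
    fix i assume i: "i \<in> I"
    show "(1 - exp (- c i)) powr (a / 2) \<le> D powr (- a / 2) * (c i / u)"
    proof (cases "c i = 0")
      case False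
      with c[OF i] have ci: "c i > 0" by simp
      have "(D * (1 - exp (- c i))) powr (a / 2) \<le> ((c i / u) powr (2 / a)) powr (a / 2)"
        using one_minus_exp_le_powr[OF D ci] a2 D ci
        by (intro powr_mono2) (auto simp: u_def[symmetric] au)
      also have "\<dots> = c i / u" using ci u a2 by (simp add: powr_powr)
      finally have "D powr (a / 2) * (1 - exp (- c i)) powr (a / 2) \<le> c i / u"
        using D ci by (simp add: powr_mult)
      then have "(1 - exp (- c i)) powr (a / 2) \<le> c i / u / D powr (a / 2)"
        using D by (subst pos_le_divide_eq) (auto simp: mult.commute)
      then show ?thesis by (simp add: powr_minus_divide mult.commute)
    qed simp
  qed
  also have "\<dots> = D powr (- a / 2) * (t / u)"
    by (simp add: t_def sum_distrib_left sum_divide_distrib)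
  finally have "(\<Sum>i\<in>I. (1 - exp (- c i)) powr (a / 2)) powr (1 / a)
      \<le> (D powr (- a / 2) * (t / u)) powr (1 / a)"
    using a2 by (intro powr_mono2) (auto intro: sum_nonneg)
  also have "\<dots> = D powr (- 1 / 2) * (t / u) powr (1 / a)"
    using D t u a2 by (subst powr_mult) (auto simp: powr_powr)
  finally have S: "(\<Sum>i\<in>I. (1 - exp (- c i)) powr (a / 2)) powr (1 / a)
      \<le> D powr (- 1 / 2) * (t / u) powr (1 / a)" .
  define t0 where "t0 = D * u"
  have t0: "t0 > 0" using D u by (simp add: t0_def)
  have et0: "exp t0 = D powr D / (D - 1) powr D"
    using D by (simp add: t0_def u_def powr_def ln_div exp_diff[symmetric] right_diff_distrib)
  \<comment> \<open>The critical activity is rewritten through \<open>t0\<close>, so that the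
    hypothesis on \<open>lam\<close> fits the right-hand side of
    \<open>powr_le_exp_mix\<close>.\<close>
  have lam_eq: "D powr D / (D - 1) powr (D + 1) = exp t0 / (D - 1)"
    using D by (simp add: et0 powr_add)
  have "D * (t / t0) powr (2 / a) \<le> 1 + (D - 1) * exp (t - t0)"
    using powr_le_exp_mix[OF D t t0] D by (simp add: t0_def mult.commute flip: au)
  also have "\<dots> = 1 + exp t / (exp t0 / (D - 1))" by (simp add: exp_diff)
  also have "\<dots> \<le> 1 + exp t / lam"
    using lam lam_eq D by (intro add_left_mono divide_left_mono) auto
  finally have "D * (t / t0) powr (2 / a) \<le> 1 + exp t / lam" .
  then have "(D * (t / t0) powr (2 / a)) powr (1 / 2) \<le> (1 + exp t / lam) powr (1 / 2)"
    using D by (intro powr_mono2) auto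
  moreover have "(D * (t / t0) powr (2 / a)) powr (1 / 2)
      = D powr (1 / 2) * (D powr (- 1 / a) * (t / u) powr (1 / a))"
    using D t u a2 by (simp add: powr_mult powr_divide powr_powr t0_def powr_minus field_simps)
  ultimately have B: "D powr (1 / 2) * (D powr (- 1 / a) * (t / u) powr (1 / a))
      \<le> (1 + exp t / lam) powr (1 / 2)" by simp
  have pos: "1 + exp t / lam > 0" using lam by (simp add: add_pos_pos)
  \<comment> \<open>The powers of \<open>D\<close> are collected here; with the factor
    \<open>D powr (- 1 / 2)\<close> of the sum the exponent becomes 1 / a - 1 = - 1 / q.\<close>
  have "(t / u) powr (1 / a)
      = D powr (1 / a - 1 / 2) * (D powr (1 / 2) * (D powr (- 1 / a) * (t / u) powr (1 / a)))"
    using D by (simp flip: powr_add mult.assoc)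
  also have "\<dots> \<le> D powr (1 / a - 1 / 2) * (1 + exp t / lam) powr (1 / 2)"
    by (intro mult_left_mono B) auto
  finally have "(t / u) powr (1 / a) \<le> D powr (1 / a - 1 / 2) * (1 + exp t / lam) powr (1 / 2)" .
  then have "D powr (- 1 / 2) * (t / u) powr (1 / a)
      \<le> D powr (- 1 / 2) * (D powr (1 / a - 1 / 2) * (1 + exp t / lam) powr (1 / 2))"
    by (intro mult_left_mono) auto
  also have "\<dots> = D powr (- 1 / q) * (1 + exp t / lam) powr (1 / 2)"
  proof -
    have "- 1 / q = - 1 / 2 + (1 / a - 1 / 2)" using qa by simp
    then show ?thesis by (simp only: powr_add mult.assoc)
  qed
  finally have "(1 + exp t / lam) powr (- 1 / 2) * (\<Sum>i\<in>I. (1 - exp (- c i)) powr (a / 2)) powr (1 / a)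
      \<le> (1 + exp t / lam) powr (- 1 / 2) * (D powr (- 1 / q) * (1 + exp t / lam) powr (1 / 2))"
    using S by (intro mult_left_mono) auto
  also have "\<dots> = D powr (- 1 / q)"
    using pos by (simp add: powr_minus)
  finally show ?thesis .
qed

text \<open>The mean value theorem along the segment from \<open>\<theta>\<close> to
  \<open>\<eta>\<close> expresses the difference as a directional derivative at one point. Hoelder
  separates the gradient, handled by \<open>contraction_factor\<close>, from the
  displacement.\<close>

lemma hardcore_map_contraction_angle:
  fixes D lam :: real and \<theta> \<eta> :: "'i \<Rightarrow> real"
  defines "q \<equiv> conj_exp D"
  assumes D: "D > 1" and lam: "lam > 0" "lam \<le> D powr D / (D - 1) powr (D + 1)"
    and \<theta>: "\<And>i. i \<in> N \<Longrightarrow> \<theta> i \<ge> 0" and \<eta>: "\<And>i. i \<in> N \<Longrightarrow> \<eta> i \<ge> 0"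
  defines "H \<equiv> \<lambda>\<theta>. arsinh (sqrt lam * exp (- (\<Sum>i\<in>N. ln (cosh (\<theta> i)))))"
  shows "\<bar>H \<eta> - H \<theta>\<bar> powr q \<le> (1 / D) * (\<Sum>i\<in>N. \<bar>\<eta> i - \<theta> i\<bar> powr q)"
proof -
  define a where "a = crit_exp D"
  have a2: "a \<ge> 2" unfolding a_def by (rule crit_exp_ge_2[OF D])
  have q1: "q > 1" unfolding q_def by (rule conj_exp_gt_1[OF D])
  have qa: "1 / a + 1 / q = 1" unfolding a_def q_def by (rule crit_conj_exp[OF D])
  define d where "d i = \<eta> i - \<theta> i" for i
  define P where "P s i = \<theta> i + s * d i" for s i
  define t where "t s = (\<Sum>i\<in>N. 2 * ln (cosh (P s i)))" for s
  define G where "G s = sqrt lam * exp (- (\<Sum>i\<in>N. ln (cosh (P s i))))" for s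
  define H' where "H' s = - (1 / sqrt (G s ^ 2 + 1)) * G s * (\<Sum>i\<in>N. tanh (P s i) * d i)" for s
  have G2: "G s ^ 2 = lam / exp (t s)" for s
  proof -
    have "exp (- (\<Sum>i\<in>N. ln (cosh (P s i)))) ^ 2 = exp (- t s)"
      by (simp add: power2_eq_square t_def sum_distrib_left[symmetric] flip: exp_add)
    then show ?thesis using lam by (simp add: G_def power_mult_distrib exp_minus field_simps)
  qed
  have Gpos: "G s > 0" for s using lam by (simp add: G_def)
  have "DERIV (\<lambda>s. \<Sum>i\<in>N. ln (cosh (P s i))) s :> (\<Sum>i\<in>N. tanh (P s i) * d i)" for s
    unfolding P_def
    by (intro DERIV_sum) (auto intro!: derivative_eq_intros simp: tanh_def)
  moreover have "DERIV (\<lambda>s. arsinh (k * exp (- f s))) s :>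
      - (1 / sqrt ((k * exp (- f s)) ^ 2 + 1)) * (k * exp (- f s)) * f'"
    if "DERIV f s :> f'" for f f' k and s :: real
  proof -
    have "DERIV (\<lambda>s. k * exp (- f s)) s :> - (k * exp (- f s)) * f'"
      using that by (auto intro!: derivative_eq_intros)
    from DERIV_chain2[OF arsinh_real_has_field_derivative this] show ?thesis by simp
  qed
  ultimately have "DERIV (\<lambda>s. H (P s)) s :> H' s" for s
    unfolding H_def H'_def G_def by blast
  then obtain z where z: "0 < z" "z < 1" "H (P 1) - H (P 0) = (1 - 0) * H' z"
    using MVT2[of 0 "1 :: real" "\<lambda>s. H (P s)" H'] by auto
  have Hd: "H \<eta> - H \<theta> = H' z"
    using z by (simp add: P_def d_def H_def)
  \<comment> \<open>A convex combination of nonnegative angles is nonnegative, so every tanh below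
    is nonnegative, as Hoelder requires.\<close>
  have Pz: "P z i \<ge> 0" if "i \<in> N" for i
  proof -
    have "P z i = (1 - z) * \<theta> i + z * \<eta> i" by (simp add: P_def d_def algebra_simps)
    then show ?thesis using z \<theta>[OF that] \<eta>[OF that] by simp
  qed
  define c where "c i = 2 * ln (cosh (P z i))" for i
  have c0: "c i \<ge> 0" for i by (simp add: c_def cosh_real_ge_1)
  have tc: "1 - exp (- c i) = tanh (P z i) ^ 2" for i
  proof -
    have "exp (c i) = cosh (P z i) ^ 2"
      by (simp add: c_def exp_double)
    then have "exp (- c i) = 1 / cosh (P z i) ^ 2" by (simp add: exp_minus field_simps)
    then show ?thesis
      by (simp add: tanh_def power_divide sinh_square_eq field_simps)
  qed
  \<comment> \<open>Since G / sqrt (G^2 + 1) = (1 + 1 / G^2) powr (- 1 / 2), inserting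
    \<open>G2\<close> gives exactly the prefactor of \<open>contraction_factor\<close>.\<close>
  have pref: "1 / sqrt (G z ^ 2 + 1) * G z = (1 + exp (t z) / lam) powr (- 1 / 2)"
  proof -
    have "1 + exp (t z) / lam = (G z ^ 2 + 1) / G z ^ 2"
      using lam by (simp add: G2 field_simps)
    then have "sqrt (1 + exp (t z) / lam) = sqrt (G z ^ 2 + 1) / G z"
      using Gpos[of z] by (simp add: real_sqrt_divide)
    then show ?thesis using lam
      by (simp add: powr_minus_divide powr_half_sqrt add_nonneg_nonneg)
  qed
  have "\<bar>H' z\<bar> = (1 + exp (t z) / lam) powr (- 1 / 2) * \<bar>\<Sum>i\<in>N. tanh (P z i) * d i\<bar>"
    unfolding H'_def pref[symmetric] using Gpos[of z] by (simp add: abs_mult)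
  also have "\<dots> \<le> (1 + exp (t z) / lam) powr (- 1 / 2) * (\<Sum>i\<in>N. tanh (P z i) * \<bar>d i\<bar>)"
    using Pz by (intro mult_left_mono order.trans[OF sum_abs] sum_mono) (auto simp: abs_mult)
  also have "\<dots> \<le> (1 + exp (t z) / lam) powr (- 1 / 2) *
     ((\<Sum>i\<in>N. tanh (P z i) powr a) powr (1 / a) * (\<Sum>i\<in>N. \<bar>d i\<bar> powr q) powr (1 / q))"
    using Pz a2 q1 qa by (intro mult_left_mono Hoelder_inequality_sum) auto
  also have "(\<Sum>i\<in>N. tanh (P z i) powr a) = (\<Sum>i\<in>N. (1 - exp (- c i)) powr (a / 2))"
  proof (intro sum.cong refl)
    fix i assume "i \<in> N"
    then have "tanh (P z i) \<ge> 0" using Pz by simp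
    then show "tanh (P z i) powr a = (1 - exp (- c i)) powr (a / 2)"
      by (cases "tanh (P z i) = 0") (simp_all add: tc powr_powr flip: powr_numeral)
  qed
  also have "(1 + exp (t z) / lam) powr (- 1 / 2) *
      ((\<Sum>i\<in>N. (1 - exp (- c i)) powr (a / 2)) powr (1 / a) * (\<Sum>i\<in>N. \<bar>d i\<bar> powr q) powr (1 / q))
      \<le> D powr (- 1 / q) * (\<Sum>i\<in>N. \<bar>d i\<bar> powr q) powr (1 / q)"
    using contraction_factor[OF D lam, of N c "t z"] c0
    by (auto simp: a_def q_def t_def c_def mult.assoc[symmetric] intro!: mult_right_mono)
  finally have "\<bar>H \<eta> - H \<theta>\<bar> \<le> D powr (- 1 / q) * (\<Sum>i\<in>N. \<bar>d i\<bar> powr q) powr (1 / q)"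
    by (simp only: Hd)
  then have "\<bar>H \<eta> - H \<theta>\<bar> powr q \<le> (D powr (- 1 / q) * (\<Sum>i\<in>N. \<bar>d i\<bar> powr q) powr (1 / q)) powr q"
    using q1 by (intro powr_mono2) auto
  also have "\<dots> = (1 / D) * (\<Sum>i\<in>N. \<bar>d i\<bar> powr q)"
    using q1 D unfolding powr_mult powr_powr by (simp add: powr_minus_divide sum_nonneg)
  finally show ?thesis by (simp add: d_def)
qed

text \<open>The angle version transported by cosh (arsinh (sqrt x)) = sqrt (1 + x), which turns the
  sum of logarithms back into the product over children.\<close>

lemma hardcore_map_contraction:
  fixes D lam :: real and x y :: "'i \<Rightarrow> real"
  defines "q \<equiv> conj_exp D"
  assumes D: "D > 1" and lam: "lam > 0" "lam \<le> D powr D / (D - 1) powr (D + 1)"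
    and fin: "finite N"
    and x: "\<And>i. i \<in> N \<Longrightarrow> x i \<ge> 0" and y: "\<And>i. i \<in> N \<Longrightarrow> y i \<ge> 0"
  defines "F \<equiv> \<lambda>x. lam * (\<Prod>i\<in>N. 1 / (1 + x i))"
  shows "\<bar>arsinh (sqrt (F x)) - arsinh (sqrt (F y))\<bar> powr q
    \<le> (1 / D) * (\<Sum>i\<in>N. \<bar>arsinh (sqrt (x i)) - arsinh (sqrt (y i))\<bar> powr q)"
proof -
  have *: "sqrt lam * exp (- (\<Sum>i\<in>N. ln (cosh (arsinh (sqrt (x i)))))) = sqrt (F x)"
    if x: "\<And>i. i \<in> N \<Longrightarrow> x i \<ge> 0" for x :: "'i \<Rightarrow> real"
  proof -
    have "exp (- (\<Sum>i\<in>N. ln (cosh (arsinh (sqrt (x i)))))) = (\<Prod>i\<in>N. sqrt (1 / (1 + x i)))"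
      unfolding sum_negf[symmetric] exp_sum[OF fin]
    proof (intro prod.cong refl)
      fix i assume "i \<in> N"
      from x[OF this] show "exp (- ln (cosh (arsinh (sqrt (x i))))) = sqrt (1 / (1 + x i))"
        by (simp add: exp_minus cosh_arsinh_real real_sqrt_divide field_simps add.commute)
    qed
    also have "\<dots> = sqrt (\<Prod>i\<in>N. 1 / (1 + x i))"
      using fin by induction (simp_all add: real_sqrt_mult real_sqrt_divide)
    finally show ?thesis by (simp add: F_def real_sqrt_mult)
  qed
  have "arsinh (sqrt r) \<ge> 0" if "r \<ge> 0" for r using that by (intro leI) simp
  then show ?thesis
    using hardcore_map_contraction_angle[OF D lam,
        of N "\<lambda>i. arsinh (sqrt (y i))" "\<lambda>i. arsinh (sqrt (x i))"] x y *[of x] *[of y]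
    by (simp add: q_def)
qed

section \<open>The tree recursion\<close>

text \<open>Removing the first entry re-roots at child \<open>i\<close>, and applies equally to
  regions, cutsets and boundary sets. Trees grow at the end of the list while the recursion peels
  its front, so the basic notions must be transferred to this view.\<close>

definition subtree :: "nat list set \<Rightarrow> nat \<Rightarrow> nat list set" where
  "subtree X i = {w. i # w \<in> X}"

lemma mem_subtree [simp]: "w \<in> subtree X i \<longleftrightarrow> i # w \<in> X"
  by (simp add: subtree_def)

lemma subtree_Un: "subtree (X \<union> Y) i = subtree X i \<union> subtree Y i"
  by auto

lemma finite_subtree: "finite X \<Longrightarrow> finite (subtree X i)"
  using finite_vimageI[of X "Cons i"] by (simp add: subtree_def vimage_def inj_def)

lemma independent_subset: "independent Y \<Longrightarrow> X \<subseteq> Y \<Longrightarrow> independent X"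
  unfolding independent_def by blast

text \<open>Every edge either lies inside one child subtree or joins the root to a child.\<close>

lemma independent_subtree_iff:
  "independent X \<longleftrightarrow> (\<forall>i. independent (subtree X i)) \<and> ([] \<in> X \<longrightarrow> (\<forall>i. [i] \<notin> X))"
proof (intro iffI conjI allI impI)
  fix i assume "independent X"
  then show "independent (subtree X i)"
    unfolding independent_def by (metis append_Cons mem_subtree)
next
  assume R: "(\<forall>i. independent (subtree X i)) \<and> ([] \<in> X \<longrightarrow> (\<forall>i. [i] \<notin> X))"
  show "independent X"
    unfolding independent_def
  proof (intro ballI allI)
    fix u i assume "u \<in> X"
    then show "u @ [i] \<notin> X"
      using R by (cases u) (auto simp: independent_def)
  qed
qed (force simp: independent_def)

lemma independent_subtree: "independent X \<Longrightarrow> independent (subtree X i)"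
  using independent_subtree_iff by blast

lemma rooted_tree_Cons:
  assumes "rooted_tree A" "i # w \<in> A"
  shows "[i] \<in> A"
  using assms(2)
proof (induction w rule: rev_induct)
  case (snoc j w)
  then show ?case using assms(1) unfolding rooted_tree_def by (metis append_Cons)
qed

lemma rooted_tree_subtree:
  assumes "rooted_tree A" "[i] \<in> A"
  shows "rooted_tree (subtree A i)"
  using assms unfolding rooted_tree_def by (metis append_Cons mem_subtree)

section \<open>Partition functions and the recursion for occupation ratios\<close>

definition part_fun :: "real \<Rightarrow> nat list set \<Rightarrow> nat list set \<Rightarrow> bool \<Rightarrow> real" where
  "part_fun lam A S occ = (\<Sum>I\<in>{I\<in>Pow A. independent (I \<union> S) \<and> ([] \<in> I) = occ}. lam ^ card I)"

definition occ_ratio :: "real \<Rightarrow> nat list set \<Rightarrow> nat list set \<Rightarrow> real" where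
  "occ_ratio lam A S = part_fun lam A S True / part_fun lam A S False"

text \<open>An arbitrary region in place of \<open>T_below T C\<close> keeps the recursion within
  one class of objects, since child regions need no description by a cutset.\<close>

lemma hc_R_eq_occ_ratio: "hc_R T lam C S = occ_ratio lam (T_below T C) S"
  by (simp add: hc_R_def hc_Z_def occ_ratio_def part_fun_def)

lemma part_fun_nonneg: "lam > 0 \<Longrightarrow> part_fun lam A S occ \<ge> 0"
  unfolding part_fun_def by (intro sum_nonneg) auto

lemma part_fun_False_pos:
  assumes "lam > 0" "finite A" "independent S"
  shows "part_fun lam A S False > 0"
  unfolding part_fun_def
proof (rule sum_pos2)
  show "{} \<in> {I \<in> Pow A. independent (I \<union> S) \<and> ([] \<in> I) = False}" using assms by simp
qed (use assms in auto)

text \<open>Once the state of the root is fixed, a configuration amounts to an independent choice in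
  each child subtree, and an occupied root only forbids the occupation of children. Weights multiply
  because cardinalities add.\<close>

lemma part_fun_prod:
  assumes A: "rooted_tree A" "finite A" and S: "[] \<notin> S" "independent S"
    and occ: "occ \<Longrightarrow> \<forall>i. [i] \<notin> S"
  shows "part_fun lam A S occ = lam ^ of_bool occ *
    (\<Prod>i\<in>{i. [i] \<in> A}. \<Sum>J\<in>{J\<in>Pow (subtree A i). independent (J \<union> subtree S i) \<and> (occ \<longrightarrow> [] \<notin> J)}.
       lam ^ card J)"
proof -
  define N where "N = {i. [i] \<in> A}"
  define B where "B i = {J\<in>Pow (subtree A i). independent (J \<union> subtree S i) \<and> (occ \<longrightarrow> [] \<notin> J)}" for i
  define join where "join g = (if occ then {[]} else {}) \<union> (\<Union>i\<in>N. Cons i ` g i)"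
    for g :: "nat \<Rightarrow> nat list set"
  have "N = (\<lambda>i. [i]) -` A" by (auto simp: N_def)
  then have finN: "finite N" using A by (simp add: finite_vimageI inj_def)
  have finB: "finite (B i)" for i unfolding B_def using A by (simp add: finite_subtree)
  have NA: "i \<in> N" if "i # w \<in> A" for i w using rooted_tree_Cons[OF A(1) that] by (simp add: N_def)
  have [simp]: "i # w \<in> join g \<longleftrightarrow> i \<in> N \<and> w \<in> g i" for i w g by (auto simp: join_def)
  have [simp]: "[] \<in> join g \<longleftrightarrow> occ" for g by (auto simp: join_def)
  have "part_fun lam A S occ = (\<Sum>g\<in>PiE N B. lam ^ of_bool occ * (\<Prod>i\<in>N. lam ^ card (g i)))"
    unfolding part_fun_def
  \<comment> \<open>\<open>join\<close> glues a family of child configurations to the prescribed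
    root state; restriction to the child subtrees is its inverse.\<close>
  proof (rule sum.reindex_bij_witness[of _ join "\<lambda>I. restrict (subtree I) N"])
    fix I assume I: "I \<in> {I \<in> Pow A. independent (I \<union> S) \<and> ([] \<in> I) = occ}"
    have fI: "finite I" using I A by (auto intro: finite_subset)
    show join_I: "join (restrict (subtree I) N) = I"
    proof (rule set_eqI)
      fix w show "w \<in> join (restrict (subtree I) N) \<longleftrightarrow> w \<in> I"
        using I NA by (cases w) auto
    qed
    show "restrict (subtree I) N \<in> PiE N B"
    proof (rule restrict_PiE_iff[THEN iffD2], rule ballI)
      fix i assume "i \<in> N"
      have "independent (subtree (I \<union> S) i)" "[] \<in> I \<longrightarrow> [i] \<notin> I \<union> S"
        using I independent_subtree_iff[of "I \<union> S"] by auto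
      then show "subtree I i \<in> B i"
        using I by (auto simp: B_def subtree_Un)
    qed
    have "card I = card ((if occ then {[]} else {}) \<union> (\<Union>i\<in>N. Cons i ` subtree I i))"
      using arg_cong[OF join_I, of card] by (simp add: join_def)
    also have "\<dots> = of_bool occ + (\<Sum>i\<in>N. card (Cons i ` subtree I i))"
    proof (subst card_Un_disjoint)
      show "card (if occ then {[]} else {}) + card (\<Union>i\<in>N. Cons i ` subtree I i)
          = of_bool occ + (\<Sum>i\<in>N. card (Cons i ` subtree I i))"
        by (subst card_UN_disjoint) (use finN fI in \<open>auto simp: finite_subtree\<close>)
    qed (use finN fI in \<open>auto simp: finite_subtree\<close>)
    also have "(\<Sum>i\<in>N. card (Cons i ` subtree I i)) = (\<Sum>i\<in>N. card (subtree I i))"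
      by (intro sum.cong refl card_image) simp
    finally show "lam ^ of_bool occ * (\<Prod>i\<in>N. lam ^ card (restrict (subtree I) N i)) = lam ^ card I"
      by (simp add: power_add power_sum)
  next
    fix g assume g: "g \<in> PiE N B"
    have sub: "subtree (join g) i = (if i \<in> N then g i else {})" for i by (rule set_eqI) simp
    show "restrict (subtree (join g)) N = g"
    proof
      fix i show "restrict (subtree (join g)) N i = g i"
        by (cases "i \<in> N") (simp_all add: sub PiE_arb[OF g])
    qed
    have gB: "g i \<in> B i" if "i \<in> N" for i using g that by auto
    have "independent (join g \<union> S)"
      unfolding independent_subtree_iff[of "join g \<union> S"]
    proof (intro conjI allI impI)
      fix i
      have "independent (subtree S i)" using S independent_subtree by blast
      then show "independent (subtree (join g \<union> S) i)"
        using gB[of i] by (auto simp: subtree_Un sub B_def)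
    next
      \<comment> \<open>As \<open>[]\<close> is not in \<open>S\<close>, the root comes from
        \<open>join g\<close>. Its children are then empty in \<open>join g\<close> by the choice of
        \<open>B\<close> and in \<open>S\<close> by the hypothesis on \<open>occ\<close>.\<close>
      fix i assume "[] \<in> join g \<union> S"
      then have occ using S by simp
      then show "[i] \<notin> join g \<union> S"
        using gB[of i] occ by (auto simp: B_def)
    qed
    moreover have "join g \<subseteq> A"
    proof
      fix w assume w: "w \<in> join g"
      show "w \<in> A"
      proof (cases w)
        case Nil then show ?thesis using A by (simp add: rooted_tree_def)
      next
        case (Cons i v) then show ?thesis using w gB[of i] by (auto simp: B_def)
      qed
    qed
    ultimately show "join g \<in> {I \<in> Pow A. independent (I \<union> S) \<and> ([] \<in> I) = occ}" by simp
  qed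
  also have "\<dots> = lam ^ of_bool occ * (\<Prod>i\<in>N. \<Sum>J\<in>B i. lam ^ card J)"
    by (subst prod_sum_PiE) (auto simp: finN finB sum_distrib_left)
  finally show ?thesis unfolding N_def B_def .
qed

lemma part_fun_True_rec:
  assumes "rooted_tree A" "finite A" "[] \<notin> S" "independent S" "\<forall>i. [i] \<notin> S"
  shows "part_fun lam A S True = lam * (\<Prod>i\<in>{i. [i] \<in> A}. part_fun lam (subtree A i) (subtree S i) False)"
  using assms by (subst part_fun_prod) (auto simp: part_fun_def)

lemma part_fun_False_rec:
  assumes "rooted_tree A" "finite A" "[] \<notin> S" "independent S"
  shows "part_fun lam A S False = (\<Prod>i\<in>{i. [i] \<in> A}.
    part_fun lam (subtree A i) (subtree S i) True + part_fun lam (subtree A i) (subtree S i) False)"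
proof -
  have "(\<Sum>J\<in>{J\<in>Pow X. independent (J \<union> Y)}. lam ^ card J) = part_fun lam X Y True + part_fun lam X Y False"
    if "finite X" for X Y
  proof -
    have "{J\<in>Pow X. independent (J \<union> Y)} =
      {J\<in>Pow X. independent (J \<union> Y) \<and> ([] \<in> J) = True} \<union>
      {J\<in>Pow X. independent (J \<union> Y) \<and> ([] \<in> J) = False}" by blast
    then show ?thesis
      unfolding part_fun_def using that by (simp only:) (subst sum.union_disjoint; auto)
  qed
  then show ?thesis using assms by (subst part_fun_prod) (auto simp: finite_subtree)
qed

lemma occ_ratio_nonneg: "lam > 0 \<Longrightarrow> occ_ratio lam A S \<ge> 0"
  by (simp add: occ_ratio_def part_fun_nonneg)

text \<open>Dividing the two product formulas gives it factor by factor. A child in \<open>S\<close>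
  would force the ratio 0, which the product does not record; hence the condition on
  \<open>[i]\<close>.\<close>

lemma occ_ratio_rec:
  assumes lam: "lam > 0" and A: "rooted_tree A" "finite A"
    and S: "[] \<notin> S" "independent S" "\<forall>i. [i] \<notin> S"
  shows "occ_ratio lam A S =
    lam * (\<Prod>i\<in>{i. [i] \<in> A}. 1 / (1 + occ_ratio lam (subtree A i) (subtree S i)))"
proof -
  have "occ_ratio lam A S = lam * (\<Prod>i\<in>{i. [i] \<in> A}.
      part_fun lam (subtree A i) (subtree S i) False /
      (part_fun lam (subtree A i) (subtree S i) True + part_fun lam (subtree A i) (subtree S i) False))"
    unfolding occ_ratio_def part_fun_True_rec[OF A S] part_fun_False_rec[OF A S(1,2)]
    by (simp add: prod_dividef)
  also have "\<dots> = lam * (\<Prod>i\<in>{i. [i] \<in> A}. 1 / (1 + occ_ratio lam (subtree A i) (subtree S i)))"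
  proof (intro arg_cong[of _ _ "(*) lam"] prod.cong refl)
    fix i
    have "part_fun lam (subtree A i) (subtree S i) False > 0"
      using lam A S by (intro part_fun_False_pos) (auto simp: finite_subtree independent_subtree)
    then show "part_fun lam (subtree A i) (subtree S i) False /
      (part_fun lam (subtree A i) (subtree S i) True + part_fun lam (subtree A i) (subtree S i) False)
      = 1 / (1 + occ_ratio lam (subtree A i) (subtree S i))"
      by (simp add: occ_ratio_def divide_simps)
  qed
  finally show ?thesis .
qed

text \<open>All factors in the recursion are at most 1; if a child is occupied by the boundary
  condition, the numerator is an empty sum.\<close>

lemma occ_ratio_le:
  assumes lam: "lam > 0" and A: "rooted_tree A" "finite A" and S: "[] \<notin> S" "independent S"
  shows "occ_ratio lam A S \<le> lam"
proof (cases "\<forall>i. [i] \<notin> S")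
  case True
  have "(\<Prod>i\<in>{i. [i] \<in> A}. 1 / (1 + occ_ratio lam (subtree A i) (subtree S i))) \<le> 1"
    using occ_ratio_nonneg[OF lam] by (intro prod_le_1) (auto simp: divide_le_eq add_pos_nonneg add_nonneg_nonneg)
  then show ?thesis using lam occ_ratio_rec[OF lam A S True] by (simp add: mult_left_le)
next
  case False
  then obtain i where i: "[i] \<in> S" by blast
  have "\<not> independent (I \<union> S)" if "[] \<in> I" for I
    using i that by (auto simp: independent_subtree_iff[of "I \<union> S"])
  then have "{I \<in> Pow A. independent (I \<union> S) \<and> ([] \<in> I) = True} = {}" by auto
  then have "part_fun lam A S True = 0" by (simp only: part_fun_def sum.empty)
  then show ?thesis using lam by (simp add: occ_ratio_def)
qed

text \<open>Induction on the size of the region. The q-th powers of the angle differences are added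
  over the children and multiplied by 1 / D, just as the weights of the child cutsets combine into
  that of \<open>C\<close>. The leading \<open>D\<close> is there because the bound starts at
  parents of cutset vertices, one level above them.\<close>

lemma occ_ratio_decay:
  fixes D lam :: real
  defines "q \<equiv> conj_exp D" and "M \<equiv> arsinh (sqrt lam)"
  assumes D: "D > 1" and lam: "lam > 0" "lam \<le> D powr D / (D - 1) powr (D + 1)"
    and "rooted_tree A" "finite A" "finite C" "[] \<notin> C" "independent C" "S \<subseteq> C" "S' \<subseteq> C"
  shows "\<bar>arsinh (sqrt (occ_ratio lam A S)) - arsinh (sqrt (occ_ratio lam A S'))\<bar> powr q
    \<le> D * M powr q * (\<Sum>v\<in>C. D powr (- real (length v)))"
  using assms(6-)
proof (induction "card A" arbitrary: A C S S' rule: less_induct)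
  case less
  note A = less.prems(1,2) and C = less.prems(3-5) and SC = less.prems(6,7)
  have q1: "q > 1" unfolding q_def by (rule conj_exp_gt_1[OF D])
  have S: "[] \<notin> S" "independent S" and S': "[] \<notin> S'" "independent S'"
    using C SC independent_subset by auto
  define W where "W X = (\<Sum>v\<in>X. D powr (- real (length v)))" for X :: "nat list set"
  have W0: "W X \<ge> 0" for X unfolding W_def by (intro sum_nonneg) simp
  show ?case
  proof (cases "\<exists>i. [i] \<in> C")
    txt \<open>Next to \<open>C\<close> a child may have ratio \<open>\<infinity>\<close>, so the contraction is not available there; the
      a priori bound \<open>M\<close> is charged to the summand of that child.\<close>
    case True
    then obtain i where i: "[i] \<in> C" by blast
    have "0 \<le> arsinh (sqrt (occ_ratio lam A X)) \<and> arsinh (sqrt (occ_ratio lam A X)) \<le> M"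
      if X: "[] \<notin> X" "independent X" for X
    proof
      show "0 \<le> arsinh (sqrt (occ_ratio lam A X))"
        using occ_ratio_nonneg[OF lam(1)] by (intro leI) (simp add: not_less)
      show "arsinh (sqrt (occ_ratio lam A X)) \<le> M"
        using occ_ratio_le[OF lam(1) A X] by (intro leI) (simp add: M_def not_less)
    qed
    from this[OF S] this[OF S'] have "\<bar>arsinh (sqrt (occ_ratio lam A S)) - arsinh (sqrt (occ_ratio lam A S'))\<bar> \<le> M"
      by linarith
    then have "\<bar>arsinh (sqrt (occ_ratio lam A S)) - arsinh (sqrt (occ_ratio lam A S'))\<bar> powr q \<le> M powr q"
      using q1 by (intro powr_mono2) auto
    also have "\<dots> = D * M powr q * D powr (- real (length [i]))"
      using D by (simp add: powr_minus_divide)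
    also have "\<dots> \<le> D * M powr q * W C"
      unfolding W_def using D i C by (intro mult_left_mono member_le_sum) auto
    finally show ?thesis by (simp add: W_def)
  next
    case False
    define N where "N = {i. [i] \<in> A}"
    have "N = (\<lambda>i. [i]) -` A" by (auto simp: N_def)
    then have finN: "finite N" using A by (simp add: finite_vimageI inj_def)
    define \<theta> where "\<theta> X i = arsinh (sqrt (occ_ratio lam (subtree A i) (subtree X i)))" for X i
    have rec: "occ_ratio lam A X = lam * (\<Prod>i\<in>N. 1 / (1 + occ_ratio lam (subtree A i) (subtree X i)))"
      if "X \<subseteq> C" for X
      unfolding N_def using that C False independent_subset[OF C(3) that]
      by (intro occ_ratio_rec lam(1) A) auto
    have "\<bar>arsinh (sqrt (occ_ratio lam A S)) - arsinh (sqrt (occ_ratio lam A S'))\<bar> powr q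
      \<le> 1 / D * (\<Sum>i\<in>N. \<bar>\<theta> S i - \<theta> S' i\<bar> powr q)"
      unfolding rec[OF SC(1)] rec[OF SC(2)] \<theta>_def q_def
      by (intro hardcore_map_contraction D lam finN occ_ratio_nonneg)
    also have "\<dots> \<le> 1 / D * (\<Sum>i\<in>N. D * M powr q * W (subtree C i))"
    proof (intro mult_left_mono sum_mono)
      fix i assume "i \<in> N"
      then have i: "[i] \<in> A" by (simp add: N_def)
      \<comment> \<open>The shifted copy misses the root, so the child region is strictly
        smaller.\<close>
      have "Cons i ` subtree A i \<subset> A"
        using A by (auto simp: rooted_tree_def)
      then have "card (Cons i ` subtree A i) < card A" using A by (intro psubset_card_mono)
      then have "card (subtree A i) < card A" by (simp add: card_image)
      then show "\<bar>\<theta> S i - \<theta> S' i\<bar> powr q \<le> D * M powr q * W (subtree C i)"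
        unfolding \<theta>_def W_def
        using A C SC False i
        by (intro less.hyps) (auto simp: finite_subtree independent_subtree rooted_tree_subtree)
    qed (use D in auto)
    also have "\<dots> = D * M powr q * (\<Sum>i\<in>N. 1 / D * W (subtree C i))"
      using D by (simp add: sum_distrib_left field_simps)
    also have "(\<Sum>i\<in>N. 1 / D * W (subtree C i)) \<le> W C"
    proof -
      \<comment> \<open>Prefixing \<open>i\<close> lengthens each vertex by one, which accounts for
        the factor 1 / D; the shifted copies are disjoint parts of \<open>C\<close>.\<close>
      have "1 / D * W (subtree C i) = W (Cons i ` subtree C i)" for i
        using D by (simp add: W_def sum.reindex sum_distrib_left powr_minus_divide powr_add mult.commute)
      then have "(\<Sum>i\<in>N. 1 / D * W (subtree C i)) = W (\<Union>i\<in>N. Cons i ` subtree C i)"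
        unfolding W_def using finN C
        by (subst sum.UNION_disjoint) (auto simp: finite_subtree)
      also have "\<dots> \<le> W C"
        unfolding W_def using C by (intro sum_mono2) auto
      finally show ?thesis .
    qed
    finally show ?thesis using D by (simp add: W_def mult_left_mono)
  qed
qed

text \<open>Returns from angles to ratios. The mean value theorem for sinh contributes cosh M = sqrt
  (1 + lam), and factoring x - y as a difference of squares contributes at most 2 * sqrt
  lam.\<close>

lemma sqrt_arsinh_Lipschitz:
  fixes x y lam :: real
  assumes "0 \<le> x" "x \<le> lam" "0 \<le> y" "y \<le> lam"
  shows "\<bar>x - y\<bar> \<le> 2 * sqrt lam * sqrt (1 + lam) * \<bar>arsinh (sqrt x) - arsinh (sqrt y)\<bar>"
proof -
  define M where "M = arsinh (sqrt lam)"
  have "0 \<le> lam" using assms by linarith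
  then have coshM: "cosh M = sqrt (1 + lam)" by (simp add: M_def cosh_arsinh_real add.commute)
  have *: "\<bar>sinh b - sinh a\<bar> \<le> cosh M * \<bar>b - a\<bar>" if "0 \<le> a" "a < b" "b \<le> M" for a b
  proof -
    have "\<exists>z>a. z < b \<and> sinh b - sinh a = (b - a) * cosh z"
      by (rule MVT2[OF \<open>a < b\<close>]) (auto intro!: derivative_eq_intros)
    then obtain z where "a < z" "z < b" "sinh b - sinh a = (b - a) * cosh z" by blast
    moreover from this have "cosh z \<le> cosh M"
      using that by (intro cosh_real_nonneg_le_iff[THEN iffD2]) auto
    ultimately show ?thesis using that by (simp add: abs_mult mult.commute mult_left_mono)
  qed
  have less: "\<bar>sqrt x - sqrt y\<bar> \<le> cosh M * \<bar>arsinh (sqrt x) - arsinh (sqrt y)\<bar>"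
    if "0 \<le> x" "x \<le> lam" "0 \<le> y" "y \<le> lam" "x < y" for x y
  proof -
    have "0 \<le> arsinh (sqrt x)" "arsinh (sqrt y) \<le> M"
      by (rule leI, use that in \<open>simp add: M_def\<close>)+
    then have "\<bar>sqrt y - sqrt x\<bar> \<le> cosh M * \<bar>arsinh (sqrt y) - arsinh (sqrt x)\<bar>"
      using *[of "arsinh (sqrt x)" "arsinh (sqrt y)"] that by simp
    then show ?thesis by (simp add: abs_minus_commute)
  qed
  have "\<bar>sqrt x - sqrt y\<bar> \<le> cosh M * \<bar>arsinh (sqrt x) - arsinh (sqrt y)\<bar>"
    using less[of x y] less[of y x] assms
    unfolding abs_minus_commute[of "sqrt y"] abs_minus_commute[of "arsinh (sqrt y)"]
    by (cases x y rule: linorder_cases) auto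
  moreover have "x - y = (sqrt x + sqrt y) * (sqrt x - sqrt y)"
    using assms by (simp add: algebra_simps)
  then have "\<bar>x - y\<bar> = (sqrt x + sqrt y) * \<bar>sqrt x - sqrt y\<bar>"
    using assms by (simp add: abs_mult)
  moreover have "sqrt x + sqrt y \<le> 2 * sqrt lam"
    using real_sqrt_le_mono[OF assms(2)] real_sqrt_le_mono[OF assms(4)] by linarith
  ultimately have "\<bar>x - y\<bar> \<le> 2 * sqrt lam * (cosh M * \<bar>arsinh (sqrt x) - arsinh (sqrt y)\<bar>)"
    using \<open>0 \<le> lam\<close> by (simp only:) (intro mult_mono; simp)
  then show ?thesis by (simp add: coshM)
qed

section \<open>Cutsets and the branching factor\<close>

text \<open>Starting at the root, one keeps moving to a child with infinitely many descendants;
  finite branching guarantees that there is one.\<close>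

lemma koenig:
  assumes A: "rooted_tree A" and fin: "\<And>v. v \<in> A \<Longrightarrow> finite (children A v)" and inf: "infinite A"
  obtains f where "infinite_path A f"
proof -
  define below where "below v = {w \<in> A. anc_eq v w}" for v
  have step: "\<exists>i. v @ [i] \<in> A \<and> infinite (below (v @ [i]))" if v: "v \<in> A" "infinite (below v)" for v
  proof (rule ccontr)
    assume no: "\<nexists>i. v @ [i] \<in> A \<and> infinite (below (v @ [i]))"
    have "below v \<subseteq> insert v (\<Union>i\<in>children A v. below (v @ [i]))"
    proof
      fix w assume w: "w \<in> below v"
      then obtain u where u: "w = v @ u" "w \<in> A" by (auto simp: below_def anc_eq_def)
      show "w \<in> insert v (\<Union>i\<in>children A v. below (v @ [i]))"
      proof (cases u)
        case (Cons i u')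
        have "v @ i # u' \<in> A \<Longrightarrow> v @ [i] \<in> A"
        proof (induction u' rule: rev_induct)
          case (snoc j u')
          then show ?case using A unfolding rooted_tree_def by (metis append_Cons append_assoc)
        qed
        then show ?thesis using u Cons by (auto simp: below_def anc_eq_def children_def)
      qed (use u in simp)
    qed
    moreover have "finite (insert v (\<Union>i\<in>children A v. below (v @ [i])))"
      using no fin[OF v(1)] by (auto simp: children_def)
    ultimately show False using v finite_subset by blast
  qed
  then obtain g where g: "\<And>v. v \<in> A \<Longrightarrow> infinite (below v) \<Longrightarrow>
      v @ [g v] \<in> A \<and> infinite (below (v @ [g v]))"
    by metis
  define f where "f n = ((\<lambda>v. v @ [g v]) ^^ n) []" for n
  have "below [] = A" by (auto simp: below_def anc_eq_def)
  then have "f n \<in> A \<and> infinite (below (f n))" for n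
    using A inf g by (induction n) (auto simp: f_def rooted_tree_def)
  then have "infinite_path A f" by (auto simp: infinite_path_def f_def)
  then show ?thesis by (rule that)
qed

text \<open>Needed because \<open>dist_root\<close> is a \<open>Min\<close>, which says nothing
  about the empty set.\<close>

lemma cutset_nonempty:
  assumes "rooted_tree T" "locally_finite_tree T" "infinite T" "cutset T C"
  shows "C \<noteq> {}"
proof -
  obtain f where "infinite_path T f"
    using koenig assms unfolding locally_finite_tree_def by metis
  then show ?thesis using assms by (auto simp: cutset_def)
qed

lemma cutset_independent:
  assumes "cutset T C"
  shows "independent C"
  using assms unfolding independent_def cutset_def ancestor_def by blast

lemma rooted_tree_T_below:
  assumes "rooted_tree T" "[] \<notin> C"
  shows "rooted_tree (T_below T C)"
  unfolding rooted_tree_def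
proof (intro conjI allI impI)
  show "[] \<in> T_below T C" using assms by (auto simp: rooted_tree_def T_below_def anc_eq_def)
next
  fix v i assume "v @ [i] \<in> T_below T C"
  then show "v \<in> T_below T C"
    using assms unfolding rooted_tree_def T_below_def anc_eq_def by (auto; metis append_assoc)
qed

text \<open>Otherwise Koenig's lemma yields an infinite path that stays in the region and so avoids
  \<open>C\<close>.\<close>

lemma finite_T_below:
  assumes T: "rooted_tree T" "locally_finite_tree T" and C: "cutset T C" "[] \<notin> C"
  shows "finite (T_below T C)"
proof (rule ccontr)
  assume inf: "infinite (T_below T C)"
  have sub: "T_below T C \<subseteq> T" by (auto simp: T_below_def)
  have "finite (children (T_below T C) v)" if "v \<in> T_below T C" for v
  proof (rule finite_subset)
    show "children (T_below T C) v \<subseteq> children T v" using sub by (auto simp: children_def)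
    show "finite (children T v)" using T that sub by (auto simp: locally_finite_tree_def)
  qed
  then obtain f where f: "infinite_path (T_below T C) f"
    using koenig[OF rooted_tree_T_below[OF T(1) C(2)] _ inf] by blast
  then have "infinite_path T f" using sub by (auto simp: infinite_path_def)
  then obtain n where "f n \<in> C" using C by (auto simp: cutset_def)
  moreover have "f n \<in> T_below T C" using f by (auto simp: infinite_path_def)
  ultimately show False by (auto simp: T_below_def anc_eq_def)
qed

text \<open>The strict inequality leaves room for a real \<open>D\<close> strictly above
  \<open>B\<close>: by continuity if \<open>B\<close> is real and exceeds 1, and by the blow-up of
  the critical activity at 1 if \<open>B\<close> is at most 1.\<close>

lemma less_lambda_cD:
  assumes lam: "lam > 0" and less: "ereal lam < lambda_c B"
  obtains D where "D > 1" "B < ereal D" "lam \<le> D powr D / (D - 1) powr (D + 1)"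
proof -
  note witness = that
  have near_1: thesis if "B \<le> 1"
  proof -
    \<comment> \<open>With \<open>D = 1 + e\<close> the numerator is at least 1 and, as e is at most
      1, the denominator is at most e; the quotient is therefore at least 1 / e, which is at least
      \<open>lam\<close>.\<close>
    define e where "e = min 1 (1 / lam)"
    have e: "e > 0" "e \<le> 1" "e \<le> 1 / lam" using lam by (auto simp: e_def)
    have "lam \<le> 1 / e" using e lam by (simp add: field_simps)
    also have "\<dots> \<le> (1 + e) powr (1 + e) / e powr (1 + e + 1)"
    proof (rule frac_le)
      show "1 \<le> (1 + e) powr (1 + e)" using e by (intro ge_one_powr_ge_zero) auto
      have "e powr (1 + e + 1) \<le> e powr 1" using e by (intro powr_mono') auto
      then show "e powr (1 + e + 1) \<le> e" using e by simp
    qed (use e in auto)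
    finally show ?thesis using e
      by (intro witness[of "1 + e"]) (auto intro: le_less_trans[OF \<open>B \<le> 1\<close>])
  qed
  show ?thesis
  proof (cases B)
    case (real d)
    show ?thesis
    proof (cases "d \<le> 1")
      case True then show ?thesis using near_1 real by (simp add: one_ereal_def)
    next
      case False
      define h where "h x = x powr x / (x - 1) powr (x + 1)" for x :: real
      have "isCont h d" unfolding h_def using False by (intro continuous_intros) auto
      moreover have "lam < h d" using less real False by (simp add: lambda_c_def h_def)
      ultimately have "eventually (\<lambda>x. lam < h x) (at d)"
        by (auto simp: isCont_def intro: order_tendstoD)
      then have "eventually (\<lambda>x. lam < h x) (at_right d)"
        by (rule filter_leD[OF at_le, rotated]) simp
      then obtain x where "x > d" "\<And>y. y > d \<Longrightarrow> y < x \<Longrightarrow> lam < h y"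
        by (auto simp: eventually_at_right_field)
      then have "lam < h ((d + x) / 2)" "(d + x) / 2 > d" by auto
      then show ?thesis using that[of "(d + x) / 2"] False real by (auto simp: h_def)
    qed
  next
    case PInf
    have "lambda_c \<infinity> = 0"
      unfolding lambda_c_def infinity_ereal_def by (simp only: ereal.case)
    then show ?thesis using less lam PInf by simp
  next
    case MInf
    then show ?thesis using near_1 by simp
  qed
qed

text \<open>Some b below D has infimum 0, and raising the base to D only decreases each
  weight.\<close>

lemma cutset_sum_small:
  assumes "branching_factor T < ereal D" "\<epsilon> > 0"
  obtains C where "cutset T C" "(\<Sum>v\<in>C. D powr (- real (length v))) < \<epsilon>"
proof -
  from assms(1) obtain b where b: "b > 0" "b < D"
    "(INF C\<in>{C. cutset T C}. ereal (\<Sum>v\<in>C. b powr (- real (length v)))) = 0"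
    unfolding branching_factor_def Inf_less_iff by auto
  then have "(INF C\<in>{C. cutset T C}. ereal (\<Sum>v\<in>C. b powr (- real (length v)))) < ereal \<epsilon>"
    using assms(2) by simp
  then obtain C where C: "cutset T C" "(\<Sum>v\<in>C. b powr (- real (length v))) < \<epsilon>"
    unfolding INF_less_iff by auto
  have "(\<Sum>v\<in>C. D powr (- real (length v))) \<le> (\<Sum>v\<in>C. b powr (- real (length v)))"
    using b by (intro sum_mono powr_mono2') auto
  with C show ?thesis by (intro that[of C]) auto
qed

section \<open>From light cutsets to uniqueness\<close>

lemma discrepancy_bounds:
  assumes "finite C" and "\<And>S S'. S \<subseteq> C \<Longrightarrow> S' \<subseteq> C \<Longrightarrow> hc_R T lam C S - hc_R T lam C S' \<le> K"
  shows "0 \<le> discrepancy T lam C" "discrepancy T lam C \<le> K"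
proof -
  define X where "X = {hc_R T lam C S - hc_R T lam C S' | S S'. S \<subseteq> C \<and> S' \<subseteq> C}"
  have "X = (\<lambda>(S, S'). hc_R T lam C S - hc_R T lam C S') ` (Pow C \<times> Pow C)"
    by (auto simp: X_def)
  then have fin: "finite X" using assms(1) by simp
  \<comment> \<open>Equal boundary conditions put 0 into the set, which gives both the lower bound
    and the nonemptiness that \<open>Max\<close> requires.\<close>
  have "hc_R T lam C {} - hc_R T lam C {} \<in> X" unfolding X_def by blast
  then have 0: "0 \<in> X" by simp
  show "0 \<le> discrepancy T lam C"
    unfolding discrepancy_def X_def[symmetric] using fin 0 by simp
  show "discrepancy T lam C \<le> K"
    unfolding discrepancy_def X_def[symmetric] using fin 0 assms(2)
    by (subst Max_le_iff) (auto simp: X_def)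
qed

lemma discrepancy_le:
  fixes D lam \<epsilon> :: real
  defines "q \<equiv> conj_exp D"
  assumes T: "rooted_tree T" "locally_finite_tree T" and C: "cutset T C" "[] \<notin> C"
    and D: "D > 1" and lam: "lam > 0" "lam \<le> D powr D / (D - 1) powr (D + 1)"
    and small: "(\<Sum>v\<in>C. D powr (- real (length v))) \<le> \<epsilon>"
  shows "0 \<le> discrepancy T lam C"
    and "discrepancy T lam C
      \<le> 2 * sqrt lam * sqrt (1 + lam) * (D * arsinh (sqrt lam) powr q * \<epsilon>) powr (1 / q)"
proof -
  have q1: "q > 1" unfolding q_def by (rule conj_exp_gt_1[OF D])
  have finC: "finite C" using C by (simp add: cutset_def)
  let ?A = "T_below T C"
  note A = rooted_tree_T_below[OF T(1) C(2)] finite_T_below[OF T C]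
  note indep = cutset_independent[OF C(1)]
  have "hc_R T lam C S - hc_R T lam C S'
      \<le> 2 * sqrt lam * sqrt (1 + lam) * (D * arsinh (sqrt lam) powr q * \<epsilon>) powr (1 / q)"
    if S: "S \<subseteq> C" "S' \<subseteq> C" for S S'
  proof -
    let ?\<delta> = "\<bar>arsinh (sqrt (occ_ratio lam ?A S)) - arsinh (sqrt (occ_ratio lam ?A S'))\<bar>"
    have "?\<delta> powr q \<le> D * arsinh (sqrt lam) powr q * (\<Sum>v\<in>C. D powr (- real (length v)))"
      unfolding q_def by (rule occ_ratio_decay[OF D lam A finC C(2) indep S])
    also have "\<dots> \<le> D * arsinh (sqrt lam) powr q * \<epsilon>"
      using D small by (intro mult_left_mono) auto
    finally have "(?\<delta> powr q) powr (1 / q) \<le> (D * arsinh (sqrt lam) powr q * \<epsilon>) powr (1 / q)"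
      using q1 by (intro powr_mono2) auto
    then have \<delta>: "?\<delta> \<le> (D * arsinh (sqrt lam) powr q * \<epsilon>) powr (1 / q)"
      using q1 by (simp add: powr_powr)
    have R: "0 \<le> occ_ratio lam ?A X \<and> occ_ratio lam ?A X \<le> lam" if "X \<subseteq> C" for X
      using that C(2) independent_subset[OF indep that]
      by (auto intro!: occ_ratio_nonneg occ_ratio_le lam A)
    have "hc_R T lam C S - hc_R T lam C S' \<le> \<bar>occ_ratio lam ?A S - occ_ratio lam ?A S'\<bar>"
      by (simp add: hc_R_eq_occ_ratio)
    also have "\<dots> \<le> 2 * sqrt lam * sqrt (1 + lam) * ?\<delta>"
      using R[OF S(1)] R[OF S(2)] by (intro sqrt_arsinh_Lipschitz) auto
    also have "\<dots> \<le> 2 * sqrt lam * sqrt (1 + lam) * (D * arsinh (sqrt lam) powr q * \<epsilon>) powr (1 / q)"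
      using \<delta> lam by (intro mult_left_mono) auto
    finally show ?thesis .
  qed
  from discrepancy_bounds[OF finC this]
  show "0 \<le> discrepancy T lam C" "discrepancy T lam C
      \<le> 2 * sqrt lam * sqrt (1 + lam) * (D * arsinh (sqrt lam) powr q * \<epsilon>) powr (1 / q)"
    by blast+
qed

text \<open>One choice serves both limits: cutsets of weight below 1 / (n + 1). A vertex near the
  root would alone weigh too much, so the distances tend to infinity, while
  \<open>discrepancy_le\<close> makes the discrepancies vanish.\<close>

lemma gibbs_uniqueness_if_branching_factor_less:
  fixes D lam :: real
  assumes T: "rooted_tree T" "locally_finite_tree T" "infinite T"
    and D: "branching_factor T < ereal D" "D > 1"
    and lam: "lam > 0" "lam \<le> D powr D / (D - 1) powr (D + 1)"
  shows "gibbs_uniqueness T lam"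
proof -
  define W where "W X = (\<Sum>v\<in>X. D powr (- real (length v)))" for X :: "nat list set"
  have "\<exists>C. cutset T C \<and> W C < 1 / Suc n" for n
    unfolding W_def using cutset_sum_small[OF D(1), of "1 / Suc n"] by force
  then obtain B where B: "\<And>n. cutset T (B n)" "\<And>n. W (B n) < 1 / Suc n"
    by metis
  have finB: "finite (B n)" and ne: "B n \<noteq> {}" for n
    using B(1) cutset_nonempty[OF T B(1)] by (auto simp: cutset_def)
  have term_less: "D powr (- real (length v)) < 1 / Suc n" if "v \<in> B n" for v n
  proof -
    have "D powr (- real (length v)) \<le> W (B n)"
      unfolding W_def using that finB by (intro member_le_sum) auto
    with B(2) show ?thesis by (rule le_less_trans[rotated])
  qed
  \<comment> \<open>The root alone has weight 1, which is never below 1 / (n + 1).\<close>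
  have root: "[] \<notin> B n" for n
    using term_less[of "[]" n] D by auto
  have inv: "(\<lambda>n. 1 / real (Suc n)) \<longlonglongrightarrow> 0" by (rule LIMSEQ_Suc[OF lim_1_over_n])
  have "filterlim (\<lambda>i. dist_root (B i)) at_top sequentially"
    unfolding filterlim_at_top
  proof
    fix k :: nat
    have "eventually (\<lambda>n. 1 / real (Suc n) < D powr (- real k)) sequentially"
      using D by (intro order_tendstoD[OF inv]) auto
    then show "eventually (\<lambda>n. k \<le> dist_root (B n)) sequentially"
    proof eventually_elim
      case (elim n)
      have "k \<le> length v" if "v \<in> B n" for v
      proof -
        have "D powr (- real (length v)) < D powr (- real k)"
          using term_less[OF that] elim by linarith
        then show ?thesis using D by simp
      qed
      then show ?case unfolding dist_root_def using finB ne by simp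
    qed
  qed
  moreover have "(\<lambda>i. discrepancy T lam (B i)) \<longlonglongrightarrow> 0"
  proof (rule tendsto_sandwich)
    let ?q = "conj_exp D"
    let ?K = "\<lambda>n. 2 * sqrt lam * sqrt (1 + lam) *
      (D * arsinh (sqrt lam) powr ?q * (1 / real (Suc n))) powr (1 / ?q)"
    note bounds = discrepancy_le[OF T(1,2) B(1) root D(2) lam less_imp_le[OF B(2)[unfolded W_def]]]
    show "\<forall>\<^sub>F n in sequentially. 0 \<le> discrepancy T lam (B n)"
      "\<forall>\<^sub>F n in sequentially. discrepancy T lam (B n) \<le> ?K n"
      using bounds by (auto intro!: always_eventually)
    have "(\<lambda>n. (D * arsinh (sqrt lam) powr ?q * (1 / real (Suc n))) powr (1 / ?q)) \<longlonglongrightarrow> 0"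
    proof (rule tendsto_zero_powrI)
      show "(\<lambda>n. D * arsinh (sqrt lam) powr ?q * (1 / real (Suc n))) \<longlonglongrightarrow> 0"
        using tendsto_mult_left[OF inv] by simp
      show "0 < 1 / ?q" using conj_exp_gt_1[OF D(2)] by simp
    qed (use D in auto)
    then show "?K \<longlonglongrightarrow> 0"
      using tendsto_mult_left[of _ 0 sequentially "2 * sqrt lam * sqrt (1 + lam)"] by simp
  qed simp
  ultimately show ?thesis unfolding gibbs_uniqueness_def using B(1) by blast
qed

theorem theorem5p7:
  fixes T :: "nat list set" and lam :: real and b :: ereal
  assumes "rooted_tree T" and "locally_finite_tree T" and "infinite T"
    and "b = branching_factor T"
    and "lam > 0"
    and "ereal lam < lambda_c (b + 1) \<or>
         (spherically_symmetric T \<and> ereal lam < lambda_c b)"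
  shows "gibbs_uniqueness T lam"
proof -
  \<comment> \<open>Each alternative supplies a \<open>B\<close> at least \<open>b\<close>, namely
    \<open>b + 1\<close> or \<open>b\<close>, so a \<open>D\<close> above \<open>B\<close> also
    exceeds the branching factor.\<close>
  have "b \<le> b + 1"
    by (cases b) auto
  then obtain B where B: "b \<le> B" "ereal lam < lambda_c B"
    using assms(6) by blast
  obtain D where "D > 1" "B < ereal D" "lam \<le> D powr D / (D - 1) powr (D + 1)"
    using less_lambda_cD[OF assms(5) B(2)] .
  then show ?thesis
    using gibbs_uniqueness_if_branching_factor_less assms(1-5) le_less_trans[OF B(1)] by blast
qed

end
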